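(* For each $i\in\{1,2\}$, let $X_i$ be a Banach space and let $V_i$ be a non-empty closed convex subset of $X_i$. Let $X=X_1\oplus_\infty X_2$ and $V=V_1\times V_2$. If $(V_i,\mathcal{CB}(X_i))$ has the restricted center property for each $i\in\{1,2\}$, then $(V,\mathcal{CB}(X))$ has the restricted center property.
   Context: All Banach spaces are real. $X_1\oplus_\infty X_2$ is $X_1\times X_2$ with the norm $\|(x_1,x_2)\|=\max\{\|x_1\|,\|x_2\|\}$. For a Banach space $E$, $\mathcal{CB}(E)$ is the class of non-empty closed bounded subsets of $E$. For $v\in E$ and a non-empty bounded set $F\subseteq E$, $r(v,F)=\sup_{z\in F}\|v-z\|$. For a non-empty closed convex $V\subseteq E$: $\mathrm{rad}_V(F)=\inf_{v\in V}r(v,F)$ and $\mathrm{cent}_V(F)=\{v\in V: r(v,F)=\mathrm{rad}_V(F)\}$. For $\mathscr F\subseteq\mathcal{CB}(E)$, the pair $(V,\mathscr F)$ has the restricted center property (r.c.p.) if $\mathrm{cent}_V(F)\ne\emptyset$ for every $F\in\mathscr F$. *)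

theory Defs
  imports "HOL-Analysis.Analysis"
begin

section \<open>The \<open>\<infinity>\<close>-direct sum of two normed spaces\<close>

text \<open>
  The library product type carries the Euclidean norm. A separate type is therefore used for
  \<open>X\<^sub>1 \<oplus>\<^sub>\<infinity> X\<^sub>2\<close>, with the componentwise vector space structure and the maximum norm.
\<close>

datatype ('a, 'b) linf_sum = Linf (linf_fst: 'a) (linf_snd: 'b)

instantiation linf_sum :: (real_normed_vector, real_normed_vector) real_normed_vector
begin

definition zero_linf_sum :: "('a, 'b) linf_sum" where
  "0 = Linf 0 0"

definition plus_linf_sum :: "('a, 'b) linf_sum \<Rightarrow> ('a, 'b) linf_sum \<Rightarrow> ('a, 'b) linf_sum" where
  "x + y = Linf (linf_fst x + linf_fst y) (linf_snd x + linf_snd y)"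

definition uminus_linf_sum :: "('a, 'b) linf_sum \<Rightarrow> ('a, 'b) linf_sum" where
  "- x = Linf (- linf_fst x) (- linf_snd x)"

definition minus_linf_sum :: "('a, 'b) linf_sum \<Rightarrow> ('a, 'b) linf_sum \<Rightarrow> ('a, 'b) linf_sum" where
  "x - y = Linf (linf_fst x - linf_fst y) (linf_snd x - linf_snd y)"

definition scaleR_linf_sum :: "real \<Rightarrow> ('a, 'b) linf_sum \<Rightarrow> ('a, 'b) linf_sum" where
  "c *\<^sub>R x = Linf (c *\<^sub>R linf_fst x) (c *\<^sub>R linf_snd x)"

definition norm_linf_sum :: "('a, 'b) linf_sum \<Rightarrow> real" where
  "norm x = max (norm (linf_fst x)) (norm (linf_snd x))"

definition sgn_linf_sum :: "('a, 'b) linf_sum \<Rightarrow> ('a, 'b) linf_sum" where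
  "sgn x = inverse (norm x) *\<^sub>R x" for x :: "('a, 'b) linf_sum"

definition dist_linf_sum :: "('a, 'b) linf_sum \<Rightarrow> ('a, 'b) linf_sum \<Rightarrow> real" where
  "dist x y = norm (x - y)" for x y :: "('a, 'b) linf_sum"

definition uniformity_linf_sum :: "(('a, 'b) linf_sum \<times> ('a, 'b) linf_sum) filter" where
  "uniformity = (INF e\<in>{0<..}. principal {(x :: ('a, 'b) linf_sum, y). dist x y < e})"

definition open_linf_sum :: "('a, 'b) linf_sum set \<Rightarrow> bool" where
  "open U = (\<forall>x\<in>U. \<forall>\<^sub>F (x', y) in uniformity. x' = x \<longrightarrow> y \<in> U)"
  for U :: "('a, 'b) linf_sum set"

instance
proof
  fix x y z :: "('a, 'b) linf_sum" and a b :: real and U :: "('a, 'b) linf_sum set"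
  note defs = zero_linf_sum_def plus_linf_sum_def uminus_linf_sum_def minus_linf_sum_def
    scaleR_linf_sum_def norm_linf_sum_def
  show "x + y + z = x + (y + z)" "x + y = y + x" "0 + x = x" "- x + x = 0" "x - y = x + - y"
    by (simp_all add: defs algebra_simps)
  show "a *\<^sub>R (x + y) = a *\<^sub>R x + a *\<^sub>R y" "(a + b) *\<^sub>R x = a *\<^sub>R x + b *\<^sub>R x"
    "a *\<^sub>R b *\<^sub>R x = (a * b) *\<^sub>R x" "1 *\<^sub>R x = x"
    by (simp_all add: defs algebra_simps)
  show "dist x y = norm (x - y)" by (rule dist_linf_sum_def)
  show "sgn x = inverse (norm x) *\<^sub>R x" by (rule sgn_linf_sum_def)
  show "uniformity = (INF e\<in>{0<..}. principal {(x :: ('a, 'b) linf_sum, y). dist x y < e})"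
    by (rule uniformity_linf_sum_def)
  show "open U = (\<forall>x\<in>U. \<forall>\<^sub>F (x', y) in uniformity. x' = x \<longrightarrow> y \<in> U)"
    by (rule open_linf_sum_def)
  show "(norm x = 0) = (x = 0)"
  proof
    assume "norm x = 0"
    then have "norm (linf_fst x) \<le> 0" "norm (linf_snd x) \<le> 0"
      by (metis norm_linf_sum_def max.cobounded1, metis norm_linf_sum_def max.cobounded2)
    then show "x = 0" by (cases x) (simp add: defs)
  qed (simp add: defs)
  show "norm (x + y) \<le> norm x + norm y"
    using norm_triangle_ineq[of "linf_fst x" "linf_fst y"]
      norm_triangle_ineq[of "linf_snd x" "linf_snd y"]
    by (auto simp: defs max_def)
  show "norm (a *\<^sub>R x) = \<bar>a\<bar> * norm x"
    by (simp add: defs max_mult_distrib_left)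
qed

end

instance linf_sum :: (banach, banach) banach
proof
  fix S :: "nat \<Rightarrow> ('a, 'b) linf_sum"
  assume S: "Cauchy S"
  have d: "dist x y = max (dist (linf_fst x) (linf_fst y)) (dist (linf_snd x) (linf_snd y))"
    for x y :: "('a, 'b) linf_sum"
    by (simp add: dist_linf_sum_def norm_linf_sum_def minus_linf_sum_def dist_norm)
  have "Cauchy (\<lambda>n. linf_fst (S n))" "Cauchy (\<lambda>n. linf_snd (S n))"
    using S unfolding Cauchy_def d max_less_iff_conj by meson+
  then obtain a b where "(\<lambda>n. linf_fst (S n)) \<longlonglongrightarrow> a" "(\<lambda>n. linf_snd (S n)) \<longlonglongrightarrow> b"
    by (meson Cauchy_convergent convergent_def)
  then have "S \<longlonglongrightarrow> Linf a b"
    by (auto simp: tendsto_iff d intro: eventually_conj)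
  then show "convergent S" by (auto simp: convergent_def)
qed

definition linf_Times :: "'a set \<Rightarrow> 'b set \<Rightarrow> ('a, 'b) linf_sum set" where
  "linf_Times A B = {Linf a b | a b. a \<in> A \<and> b \<in> B}"

section \<open>Restricted Chebyshev centers\<close>

text \<open>
  \<open>cheb_radius v F\<close> is \<open>r(v, F)\<close>; as a real supremum it is meaningful for non-empty bounded \<open>F\<close>.
  Likewise \<open>restricted_radius V F\<close> is \<open>rad\<^sub>V(F)\<close> for non-empty \<open>V\<close>.
\<close>

definition CB :: "'a::real_normed_vector set set" where
  "CB = {F. F \<noteq> {} \<and> closed F \<and> bounded F}"

definition cheb_radius :: "'a::real_normed_vector \<Rightarrow> 'a set \<Rightarrow> real" where
  "cheb_radius v F = (SUP z\<in>F. norm (v - z))"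

definition restricted_radius :: "'a::real_normed_vector set \<Rightarrow> 'a set \<Rightarrow> real" where
  "restricted_radius V F = (INF v\<in>V. cheb_radius v F)"

definition restricted_centers :: "'a::real_normed_vector set \<Rightarrow> 'a set \<Rightarrow> 'a set" where
  "restricted_centers V F = {v \<in> V. cheb_radius v F = restricted_radius V F}"

definition restricted_center_property :: "'a::real_normed_vector set \<Rightarrow> 'a set set \<Rightarrow> bool" where
  "restricted_center_property V \<F> \<longleftrightarrow> (\<forall>F\<in>\<F>. restricted_centers V F \<noteq> {})"

end

theory Submission
  imports Defs
begin

text \<open>
  The radius function splits: if \<open>F\<^sub>i\<close> is the closure of the projection of \<open>F\<close> to \<open>X\<^sub>i\<close>, then
  \<open>r((v\<^sub>1, v\<^sub>2), F) = max (r(v\<^sub>1, F\<^sub>1)) (r(v\<^sub>2, F\<^sub>2))\<close>. Hence a pair of restricted centers of \<open>F\<^sub>1\<close> and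
  \<open>F\<^sub>2\<close> minimizes both terms of the maximum at once.
\<close>

text \<open>Boundedness makes the real supremum genuine, so bounds on it can be checked pointwise.
  Radii are compared below only through their upper bounds \<open>c\<close>.\<close>

lemma cheb_radius_le_iff:
  assumes "F \<noteq> {}" and "bounded F"
  shows "cheb_radius v F \<le> c \<longleftrightarrow> (\<forall>z\<in>F. norm (v - z) \<le> c)"
proof -
  obtain B where "\<forall>z\<in>F. norm z \<le> B"
    using assms(2) by (auto simp: bounded_iff)
  then have "norm (v - z) \<le> norm v + B" if "z \<in> F" for z
    using that norm_triangle_ineq4[of v z] by fastforce
  then have "bdd_above ((\<lambda>z. norm (v - z)) ` F)"
    by (intro bdd_aboveI2)
  then show ?thesis
    using assms(1) by (simp add: cheb_radius_def cSUP_le_iff)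
qed

lemma cheb_radius_nonneg:
  assumes "F \<noteq> {}" and "bounded F"
  shows "0 \<le> cheb_radius v F"
proof -
  obtain z where "z \<in> F"
    using assms(1) by blast
  then have "norm (v - z) \<le> cheb_radius v F"
    using cheb_radius_le_iff[OF assms, of v "cheb_radius v F"] by simp
  then show ?thesis
    by (rule order_trans[OF norm_ge_zero])
qed

text \<open>An upper bound \<open>c\<close> on the radius says that the set lies in
  \<open>cball v c\<close>; this ball is closed, so it contains a set exactly when it contains its
  closure.\<close>

lemma cheb_radius_closure:
  assumes "F \<noteq> {}" and "bounded F"
  shows "cheb_radius v (closure F) = cheb_radius v F"
proof -
  have cball: "(\<forall>z\<in>S. norm (v - z) \<le> c) \<longleftrightarrow> S \<subseteq> cball v c" for S c
    by (auto simp: dist_norm)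
  have "closure F \<subseteq> cball v c \<longleftrightarrow> F \<subseteq> cball v c" for c
    using closure_subset closure_minimal[OF _ closed_cball] by (metis order_trans)
  then have "cheb_radius v (closure F) \<le> c \<longleftrightarrow> cheb_radius v F \<le> c" for c
    using assms by (simp add: cheb_radius_le_iff cball bounded_closure)
  \<comment> \<open>Two reals with the same upper bounds are equal: take each of them as
    \<open>c\<close>.\<close>
  then show ?thesis
    by (meson order_antisym order_refl)
qed

text \<open>Radii are bounded below by 0, so the infimum is a true lower bound, and it is attained
  exactly at minimizers. This removes \<open>restricted_radius\<close> from the main
  argument.\<close>

lemma mem_restricted_centers_iff:
  assumes "F \<noteq> {}" and "bounded F"
  shows "v \<in> restricted_centers V F \<longleftrightarrow> v \<in> V \<and> (\<forall>w\<in>V. cheb_radius v F \<le> cheb_radius w F)"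
proof -
  have "bdd_below ((\<lambda>w. cheb_radius w F) ` V)"
    using cheb_radius_nonneg[OF assms] by (intro bdd_belowI2)
  then have "restricted_radius V F \<le> cheb_radius w F" if "w \<in> V" for w
    unfolding restricted_radius_def using that by (rule cINF_lower)
  moreover have "cheb_radius v F = restricted_radius V F"
    if "v \<in> V" "\<forall>w\<in>V. cheb_radius v F \<le> cheb_radius w F"
    unfolding restricted_radius_def using that by (intro cInf_eq_minimum [symmetric]) auto
  ultimately show ?thesis
    by (auto simp: restricted_centers_def)
qed

lemma bounded_linf_image:
  assumes "bounded F"
  shows "bounded (linf_fst ` F)" and "bounded (linf_snd ` F)"
  using assms by (auto simp: bounded_iff norm_linf_sum_def)

text \<open>A maximum norm is at most \<open>c\<close> iff both coordinate norms are, so the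
  pointwise bounds over \<open>F\<close> separate into bounds over the two projections.\<close>

lemma cheb_radius_linf:
  assumes "F \<noteq> {}" and "bounded F"
  shows "cheb_radius (Linf v w) F =
    max (cheb_radius v (linf_fst ` F)) (cheb_radius w (linf_snd ` F))"
proof -
  have "cheb_radius (Linf v w) F \<le> c \<longleftrightarrow>
    max (cheb_radius v (linf_fst ` F)) (cheb_radius w (linf_snd ` F)) \<le> c" for c
    using assms
    by (auto simp: cheb_radius_le_iff bounded_linf_image norm_linf_sum_def minus_linf_sum_def)
  then show ?thesis
    by (meson order_antisym order_refl)
qed

theorem proposition3p2:
  fixes V1 :: "'a::banach set" and V2 :: "'b::banach set"
  assumes "V1 \<noteq> {}" and "closed V1" and "convex V1"
    and "V2 \<noteq> {}" and "closed V2" and "convex V2"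
    and "restricted_center_property V1 (CB :: 'a set set)"
    and "restricted_center_property V2 (CB :: 'b set set)"
  shows "restricted_center_property (linf_Times V1 V2) (CB :: ('a, 'b) linf_sum set set)"
  unfolding restricted_center_property_def
proof
  fix F :: "('a, 'b) linf_sum set"
  assume "F \<in> CB"
  then have F: "F \<noteq> {}" "bounded F"
    by (auto simp: CB_def)
  note bdd = bounded_linf_image[OF F(2)]
  \<comment> \<open>Projections of a closed bounded set need not be closed, so the hypotheses are
    applied to their closures.\<close>
  have CB: "closure (linf_fst ` F) \<in> CB" "closure (linf_snd ` F) \<in> CB"
    using F(1) bdd by (auto simp: CB_def)
  obtain v where v: "v \<in> restricted_centers V1 (closure (linf_fst ` F))"
    using assms(7) CB(1) by (auto simp: restricted_center_property_def)
  obtain w where w: "w \<in> restricted_centers V2 (closure (linf_snd ` F))"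
    using assms(8) CB(2) by (auto simp: restricted_center_property_def)
  have "v \<in> V1" "\<And>v'. v' \<in> V1 \<Longrightarrow> cheb_radius v (linf_fst ` F) \<le> cheb_radius v' (linf_fst ` F)"
    and "w \<in> V2" "\<And>w'. w' \<in> V2 \<Longrightarrow> cheb_radius w (linf_snd ` F) \<le> cheb_radius w' (linf_snd ` F)"
    using v w F(1) bdd by (simp_all add: mem_restricted_centers_iff cheb_radius_closure bounded_closure)
  \<comment> \<open>Each term of the maximum at \<open>Linf v w\<close> is at most the term of the
    same coordinate at any competitor.\<close>
  then have "Linf v w \<in> restricted_centers (linf_Times V1 V2) F"
    by (auto simp: mem_restricted_centers_iff[OF F] linf_Times_def cheb_radius_linf[OF F]
        le_max_iff_disj)
  then show "restricted_centers (linf_Times V1 V2) F \<noteq> {}"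
    by blast
qed

end
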